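(* Let $I$ be a finite index set. For each $i\in I$ let $(X_i,d_i)$ be a compact metric space, let $X=\prod_{i\in I}X_i$ with the product topology, and let $d_S$ be the sum-metric on $X$, $d_S(x,y)=\sum_{i\in I}d_i(x_i,y_i)$. Let $L^{d_S}$ be the Lipschitz seminorm of $d_S$ on $C(X)$, and for each $i\in I$ and $f\in C(X)$ let $$L_i(f)=\sup\Big\{\frac{|f(x)-f(y)|}{d_i(x_i,y_i)} : x,y\in X,\ x\neq y,\ x_j=y_j \text{ for all } j\neq i\Big\}.$$ Then for all $f\in C(X)$, $$L^{d_S}(f)=\max\{L_i(f): i\in I\}.$$ In particular, $f\in Lip_{d_S}(X)$ if and only if $L_i(f)<\infty$ for each $i\in I$.
   Context: $C(X)$ is the algebra of continuous $\mathbb{C}$-valued functions on $X$. For a compact metric space $(X,d)$ and $f\in C(X)$, $L^d(f)=\sup\{|f(x)-f(y)|/d(x,y): x,y\in X,\ x\neq y\}\in[0,+\infty]$, and $Lip_d(X)=\{f\in C(X): L^d(f)<\infty\}$. The quantities $L_i(f)$ may be $+\infty$. A supremum over the empty set is taken to be $0$. *)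

theory Defs
  imports "HOL-Analysis.Analysis"
begin

text \<open>Metric spaces are carrier sets with a distance function, as in the locale
  \<^locale>\<open>Metric_space\<close>, so that the factors of a product may differ from index to index.
  Elements of \<open>C(X)\<close> are total functions of which only the values on the carrier matter.\<close>

definition cont_funs :: "'b topology \<Rightarrow> ('b \<Rightarrow> complex) set" where
  "cont_funs T = {f. continuous_map T euclidean f}"

text \<open>Suprema are taken in \<^typ>\<open>ennreal\<close>, where the supremum of the empty set is \<open>0\<close>.\<close>

definition lip_seminorm :: "'b set \<Rightarrow> ('b \<Rightarrow> 'b \<Rightarrow> real) \<Rightarrow> ('b \<Rightarrow> complex) \<Rightarrow> ennreal" where
  "lip_seminorm M d f =
     Sup {ennreal (cmod (f x - f y) / d x y) | x y. x \<in> M \<and> y \<in> M \<and> x \<noteq> y}"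

definition lip_funs :: "'b set \<Rightarrow> ('b \<Rightarrow> 'b \<Rightarrow> real) \<Rightarrow> ('b \<Rightarrow> complex) set" where
  "lip_funs M d = {f \<in> cont_funs (Metric_space.mtopology M d). lip_seminorm M d f < \<infinity>}"

definition sum_metric ::
  "'i set \<Rightarrow> ('i \<Rightarrow> 'a \<Rightarrow> 'a \<Rightarrow> real) \<Rightarrow> ('i \<Rightarrow> 'a) \<Rightarrow> ('i \<Rightarrow> 'a) \<Rightarrow> real" where
  "sum_metric I d x y = (\<Sum>i\<in>I. d i (x i) (y i))"

definition coord_lip_seminorm ::
  "'i set \<Rightarrow> ('i \<Rightarrow> 'a set) \<Rightarrow> ('i \<Rightarrow> 'a \<Rightarrow> 'a \<Rightarrow> real) \<Rightarrow> 'i \<Rightarrow> (('i \<Rightarrow> 'a) \<Rightarrow> complex) \<Rightarrow> ennreal" where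
  "coord_lip_seminorm I X d i f =
     Sup {ennreal (cmod (f x - f y) / d i (x i) (y i)) | x y.
            x \<in> Pi\<^sub>E I X \<and> y \<in> Pi\<^sub>E I X \<and> x \<noteq> y \<and> (\<forall>j\<in>I. j \<noteq> i \<longrightarrow> x j = y j)}"

end

theory Submission
  imports Defs
begin

text \<open>If two points of the product differ in one coordinate only, their sum-distance is the
  distance of these coordinates, so each coordinate seminorm is a supremum over fewer pairs than
  the full seminorm. Conversely, replacing the coordinates of \<open>x\<close> by those of \<open>y\<close> one at a time
  joins any two points by a path whose steps are controlled by the coordinate seminorms and whose
  step lengths add up to the sum-distance. Membership in \<open>Lip\<close> also asks for continuity with
  respect to the sum-metric, but this follows from the Lipschitz bound.\<close>

lemma ennreal_divide_le_iff:
  assumes "0 \<le> c" "0 < b"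
  shows "ennreal (a / b) \<le> ennreal c \<longleftrightarrow> a \<le> c * b"
  using assms by (simp add: ennreal_le_iff pos_divide_le_eq)

text \<open>Clearing denominators turns a bound in \<open>ennreal\<close> into real inequalities
  that can be added along a path. Pairs with \<open>x = y\<close> may be included, since their left
  side is \<open>0\<close>.\<close>

lemma lip_seminorm_le_iff:
  assumes "Metric_space M d" "0 \<le> c"
  shows "lip_seminorm M d f \<le> ennreal c \<longleftrightarrow>
           (\<forall>x\<in>M. \<forall>y\<in>M. cmod (f x - f y) \<le> c * d x y)"
proof -
  interpret Metric_space M d by fact
  have "lip_seminorm M d f \<le> ennreal c \<longleftrightarrow>
          (\<forall>x\<in>M. \<forall>y\<in>M. x \<noteq> y \<longrightarrow> ennreal (cmod (f x - f y) / d x y) \<le> ennreal c)"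
    unfolding lip_seminorm_def by (auto simp: Sup_le_iff)
  also have "\<dots> \<longleftrightarrow> (\<forall>x\<in>M. \<forall>y\<in>M. x \<noteq> y \<longrightarrow> cmod (f x - f y) \<le> c * d x y)"
    using ennreal_divide_le_iff[OF assms(2)] mdist_pos_less by meson
  also have "\<dots> \<longleftrightarrow> (\<forall>x\<in>M. \<forall>y\<in>M. cmod (f x - f y) \<le> c * d x y)"
    using assms(2) nonneg by (metis diff_self mult_nonneg_nonneg norm_zero)
  finally show ?thesis .
qed

lemma lip_seminorm_finite_imp_continuous:
  assumes "Metric_space M d" "lip_seminorm M d f < \<infinity>"
  shows "f \<in> cont_funs (Metric_space.mtopology M d)"
proof -
  obtain c where c: "0 \<le> c" "lip_seminorm M d f = ennreal c"
    using assms(2) by (cases "lip_seminorm M d f") auto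
  then have "\<forall>x\<in>M. \<forall>y\<in>M. cmod (f x - f y) \<le> c * d x y"
    using lip_seminorm_le_iff[OF assms(1) c(1), of f] by simp
  then have "Lipschitz_continuous_map (metric (M, d)) euclidean_metric f"
    using assms(1)
    by (auto simp: Lipschitz_continuous_map_def Metric_space.mspace_metric
          Metric_space.mdist_metric dist_norm)
  then have "continuous_map (mtopology_of (metric (M, d))) euclidean f"
    using Lipschitz_continuous_imp_continuous_map by fastforce
  then show ?thesis
    using assms(1) by (simp add: cont_funs_def Metric_space.mtopology_of)
qed

text \<open>This is the estimate for a single step of the path, with the trivial step
  \<open>x = y\<close> allowed.\<close>

lemma coord_lip_seminorm_bound:
  assumes "Metric_space (X i) (d i)" "i \<in> I" "0 \<le> c" "coord_lip_seminorm I X d i f \<le> ennreal c"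
    and "x \<in> Pi\<^sub>E I X" "y \<in> Pi\<^sub>E I X" "\<And>j. \<lbrakk>j \<in> I; j \<noteq> i\<rbrakk> \<Longrightarrow> x j = y j"
  shows "cmod (f x - f y) \<le> c * d i (x i) (y i)"
proof (cases "x = y")
  case True
  then show ?thesis
    using assms(3) Metric_space.nonneg[OF assms(1)] by simp
next
  case False
  \<comment> \<open>Members of \<open>Pi\<^sub>E I X\<close> are determined by their values on
    \<open>I\<close>, so distinct points that agree off \<open>i\<close> must differ at
    \<open>i\<close>; the denominator is then positive.\<close>
  then have "x i \<noteq> y i"
    using assms(5-7) by (metis PiE_ext)
  then have "0 < d i (x i) (y i)"
    using Metric_space.mdist_pos_less[OF assms(1)] assms(2,5,6) by (meson PiE_mem)
  moreover have "ennreal (cmod (f x - f y) / d i (x i) (y i)) \<le> coord_lip_seminorm I X d i f"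
    unfolding coord_lip_seminorm_def using False assms(5-7) by (intro Sup_upper CollectI exI[of _ x] exI[of _ y]) auto
  ultimately show ?thesis
    using assms(3,4) ennreal_divide_le_iff order_trans by metis
qed

lemma Metric_space_sum_metric:
  assumes "finite I" "\<And>i. i \<in> I \<Longrightarrow> Metric_space (X i) (d i)"
  shows "Metric_space (Pi\<^sub>E I X) (sum_metric I d)"
proof
  fix x y
  show "0 \<le> sum_metric I d x y"
    unfolding sum_metric_def by (rule sum_nonneg) (rule Metric_space.nonneg[OF assms(2)])
  show "sum_metric I d x y = sum_metric I d y x"
    unfolding sum_metric_def by (rule sum.cong[OF refl]) (rule Metric_space.commute[OF assms(2)])
next
  fix x y assume x: "x \<in> Pi\<^sub>E I X" and y: "y \<in> Pi\<^sub>E I X"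
  have "sum_metric I d x y = 0 \<longleftrightarrow> (\<forall>i\<in>I. d i (x i) (y i) = 0)"
    unfolding sum_metric_def
    by (rule sum_nonneg_eq_0_iff[OF assms(1)]) (rule Metric_space.nonneg[OF assms(2)])
  also have "\<dots> \<longleftrightarrow> (\<forall>i\<in>I. x i = y i)"
    using Metric_space.zero[OF assms(2)] x y by (meson PiE_mem)
  also have "\<dots> \<longleftrightarrow> x = y"
    using x y PiE_ext by blast
  finally show "sum_metric I d x y = 0 \<longleftrightarrow> x = y" .
next
  fix x y z assume x: "x \<in> Pi\<^sub>E I X" and y: "y \<in> Pi\<^sub>E I X" and z: "z \<in> Pi\<^sub>E I X"
  have "d i (x i) (z i) \<le> d i (x i) (y i) + d i (y i) (z i)" if "i \<in> I" for i
    using Metric_space.triangle[OF assms(2)[OF that]] x y z that by (meson PiE_mem)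
  then show "sum_metric I d x z \<le> sum_metric I d x y + sum_metric I d y z"
    unfolding sum_metric_def sum.distrib[symmetric] by (rule sum_mono)
qed

lemma coord_lip_seminorm_le_lip_seminorm:
  assumes "finite I" "\<And>i. i \<in> I \<Longrightarrow> Metric_space (X i) (d i)" "i \<in> I"
  shows "coord_lip_seminorm I X d i f \<le> lip_seminorm (Pi\<^sub>E I X) (sum_metric I d) f"
proof -
  have "sum_metric I d x y = d i (x i) (y i)"
    if "x \<in> Pi\<^sub>E I X" "y \<in> Pi\<^sub>E I X" "\<forall>j\<in>I. j \<noteq> i \<longrightarrow> x j = y j" for x y
  proof -
    have "d j (x j) (y j) = 0" if "j \<in> I - {i}" for j
      using Metric_space.mdist_zero[OF assms(2)] that \<open>y \<in> _\<close> \<open>\<forall>j\<in>I. _ j\<close> by (auto simp: PiE_mem)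
    then show ?thesis
      unfolding sum_metric_def using assms(1,3) by (simp add: sum.remove)
  qed
  \<comment> \<open>With equal denominators, every quotient in the coordinate supremum is also a
    quotient in the full one.\<close>
  then show ?thesis
    unfolding coord_lip_seminorm_def lip_seminorm_def
    by (intro Sup_subset_mono) (smt (verit) Collect_mono)
qed

lemma cmod_diff_le_sum_metric:
  assumes "finite I" "\<And>i. i \<in> I \<Longrightarrow> Metric_space (X i) (d i)" "0 \<le> c"
    and "\<And>i. i \<in> I \<Longrightarrow> coord_lip_seminorm I X d i f \<le> ennreal c"
    and x: "x \<in> Pi\<^sub>E I X" and y: "y \<in> Pi\<^sub>E I X"
  shows "cmod (f x - f y) \<le> c * sum_metric I d x y"
proof -
  \<comment> \<open>The intermediate points of the path: \<open>h {}\<close> is \<open>x\<close>,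
    and inserting \<open>i\<close> into \<open>J\<close> changes coordinate \<open>i\<close>
    only.\<close>
  define h where "h J = (\<lambda>j. if j \<in> J then y j else x j)" for J
  have h: "h J \<in> Pi\<^sub>E I X" if "J \<subseteq> I" for J
    using x y that by (auto simp: h_def PiE_iff extensional_def)
  have "cmod (f x - f (h J)) \<le> c * (\<Sum>j\<in>J. d j (x j) (y j))" if "finite J" "J \<subseteq> I" for J
    using that
  proof (induction J rule: finite_induct)
    case empty
    then show ?case by (simp add: h_def)
  next
    case (insert i J)
    have "cmod (f (h J) - f (h (insert i J))) \<le> c * d i (h J i) (h (insert i J) i)"
      by (rule coord_lip_seminorm_bound[where X = X and I = I])
         (use insert assms h in \<open>auto simp: h_def\<close>)
    \<comment> \<open>As \<open>i \<notin> J\<close>, coordinate \<open>i\<close> moves straight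
      from \<open>x i\<close> to \<open>y i\<close>, which yields exactly the new summand.\<close>
    then have "cmod (f (h J) - f (h (insert i J))) \<le> c * d i (x i) (y i)"
      using insert.hyps by (simp add: h_def)
    moreover have "cmod (f x - f (h (insert i J)))
        \<le> cmod (f x - f (h J)) + cmod (f (h J) - f (h (insert i J)))"
      using norm_triangle_ineq[of "f x - f (h J)" "f (h J) - f (h (insert i J))"] by simp
    ultimately show ?case
      using insert by (simp add: distrib_left)
  qed
  \<comment> \<open>Outside \<open>I\<close> both \<open>x\<close> and \<open>y\<close> are
    \<open>undefined\<close>, so this is an equality of total functions.\<close>
  moreover have "h I = y"
    using x y by (auto simp: h_def fun_eq_iff PiE_iff extensional_def)
  ultimately show ?thesis
    using assms(1) unfolding sum_metric_def by (metis subset_refl)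
qed

text \<open>Letting \<open>C\<close> range over \<open>ennreal\<close> covers infinite coordinate
  seminorms: the bound is trivial for \<open>C = \<infinity>\<close>, and a finite \<open>C\<close>
  is a real Lipschitz constant.\<close>

lemma lip_seminorm_sum_metric_le:
  assumes "finite I" "\<And>i. i \<in> I \<Longrightarrow> Metric_space (X i) (d i)"
    and "\<And>i. i \<in> I \<Longrightarrow> coord_lip_seminorm I X d i f \<le> C"
  shows "lip_seminorm (Pi\<^sub>E I X) (sum_metric I d) f \<le> C"
proof (cases C)
  case (real c)
  then show ?thesis
    using lip_seminorm_le_iff[OF Metric_space_sum_metric[OF assms(1,2)] real(1)]
      cmod_diff_le_sum_metric[of I X d c f] assms by simp
qed simp

lemma lip_seminorm_sum_metric_eq:
  assumes "finite I" "\<And>i. i \<in> I \<Longrightarrow> Metric_space (X i) (d i)"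
  shows "lip_seminorm (Pi\<^sub>E I X) (sum_metric I d) f =
           (if I = {} then 0 else Max ((\<lambda>i. coord_lip_seminorm I X d i f) ` I))"
proof (cases "I = {}")
  case True
  then show ?thesis
    \<comment> \<open>For empty \<open>I\<close> the bound on the coordinate seminorms is vacuous,
      so \<open>C = 0\<close> is admissible.\<close>
    using lip_seminorm_sum_metric_le[of I X d f 0] by simp
next
  case False
  let ?m = "Max ((\<lambda>i. coord_lip_seminorm I X d i f) ` I)"
  have "lip_seminorm (Pi\<^sub>E I X) (sum_metric I d) f \<le> ?m"
    using assms by (intro lip_seminorm_sum_metric_le) auto
  moreover have "?m \<le> lip_seminorm (Pi\<^sub>E I X) (sum_metric I d) f"
    using assms False coord_lip_seminorm_le_lip_seminorm[OF assms] by (intro Max.boundedI) auto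
  ultimately show ?thesis
    using False by simp
qed

theorem theorem3p2:
  fixes I :: "'i set"
    and X :: "'i \<Rightarrow> 'a set"
    and d :: "'i \<Rightarrow> 'a \<Rightarrow> 'a \<Rightarrow> real"
  assumes "finite I"
    and "\<And>i. i \<in> I \<Longrightarrow> Metric_space (X i) (d i)"
    and "\<And>i. i \<in> I \<Longrightarrow> compact_space (Metric_space.mtopology (X i) (d i))"
  shows "\<forall>f \<in> cont_funs (product_topology (\<lambda>i. Metric_space.mtopology (X i) (d i)) I).
           lip_seminorm (Pi\<^sub>E I X) (sum_metric I d) f =
             (if I = {} then 0 else Max ((\<lambda>i. coord_lip_seminorm I X d i f) ` I)) \<and>
           (f \<in> lip_funs (Pi\<^sub>E I X) (sum_metric I d) \<longleftrightarrow>
             (\<forall>i\<in>I. coord_lip_seminorm I X d i f < \<infinity>))"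
proof (intro ballI conjI)
  fix f :: "('i \<Rightarrow> 'a) \<Rightarrow> complex"
  show eq: "lip_seminorm (Pi\<^sub>E I X) (sum_metric I d) f =
      (if I = {} then 0 else Max ((\<lambda>i. coord_lip_seminorm I X d i f) ` I))"
    by (rule lip_seminorm_sum_metric_eq[OF assms(1,2)])
  have "f \<in> lip_funs (Pi\<^sub>E I X) (sum_metric I d) \<longleftrightarrow>
      lip_seminorm (Pi\<^sub>E I X) (sum_metric I d) f < \<infinity>"
    using lip_seminorm_finite_imp_continuous[OF Metric_space_sum_metric[OF assms(1,2)]]
    by (auto simp: lip_funs_def)
  \<comment> \<open>A maximum over a finite nonempty set is finite iff all its members are; for
    empty \<open>I\<close> both sides hold.\<close>
  then show "f \<in> lip_funs (Pi\<^sub>E I X) (sum_metric I d) \<longleftrightarrow>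
      (\<forall>i\<in>I. coord_lip_seminorm I X d i f < \<infinity>)"
    using assms(1) by (simp add: eq)
qed

end
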